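(* Let $R\to S\to T$ be homomorphisms of commutative rings such that $S$ is a Gaussian $R$-algebra and $T$ is a Gaussian $S$-algebra. Then $T$ is a Gaussian $R$-algebra.
   Context: All rings are commutative with $1$. Let $B$ be an $A$-algebra. For $f\in B$, the (Ohm-Rush) content of $f$ (relative to $A$) is the ideal $\Omega(f)=\Omega_{BA}(f) := \bigcap\{I \subseteq A \text{ ideal} \mid f\in IB\}$ of $A$. $B$ is an Ohm-Rush algebra over $A$ if $f\in\Omega(f)B$ for all $f\in B$. An Ohm-Rush $A$-algebra $B$ is Gaussian over $A$ if $\Omega(fg)=\Omega(f)\Omega(g)$ for all $f,g\in B$. *)

theory Defs
  imports "HOL-Algebra.Algebra"
begin

text \<open>An algebra over a commutative ring \<open>A\<close> is given by its structure map, i.e. by a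
  homomorphism \<open>h\<close> from \<open>A\<close> to a commutative ring \<open>B\<close> (locale \<^locale>\<open>ring_hom_cring\<close>).\<close>

text \<open>The extension \<open>IB\<close> of an ideal \<open>I\<close> of \<open>A\<close> depends only on \<open>B\<close> and the structure map.\<close>

definition ideal_extension ::
  "('b, 'n) ring_scheme \<Rightarrow> ('a \<Rightarrow> 'b) \<Rightarrow> 'a set \<Rightarrow> 'b set"
  where "ideal_extension B h I = Idl\<^bsub>B\<^esub> (h ` I)"

definition ohm_rush_content ::
  "('a, 'm) ring_scheme \<Rightarrow> ('b, 'n) ring_scheme \<Rightarrow> ('a \<Rightarrow> 'b) \<Rightarrow> 'b \<Rightarrow> 'a set"
  where "ohm_rush_content A B h f = \<Inter>{I. ideal I A \<and> f \<in> ideal_extension B h I}"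

locale ohm_rush_algebra = ring_hom_cring A B h
  for A :: "('a, 'm) ring_scheme" (structure)
    and B :: "('b, 'n) ring_scheme" (structure)
    and h :: "'a \<Rightarrow> 'b" +
  assumes mem_extension_content:
    "f \<in> carrier B \<Longrightarrow> f \<in> ideal_extension B h (ohm_rush_content A B h f)"

locale gaussian_algebra = ohm_rush_algebra A B h
  for A :: "('a, 'm) ring_scheme" (structure)
    and B :: "('b, 'n) ring_scheme" (structure)
    and h :: "'a \<Rightarrow> 'b" +
  assumes content_mult:
    "f \<in> carrier B \<Longrightarrow> g \<in> carrier B \<Longrightarrow>
      ohm_rush_content A B h (f \<otimes>\<^bsub>B\<^esub> g) =
        ohm_rush_content A B h f \<cdot>\<^bsub>A\<^esub> ohm_rush_content A B h g"

end

theory Submission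
  imports Defs
begin

text \<open>In an Ohm-Rush algebra \<open>\<Omega>(f)\<close> is characterised by the adjunction
  \<open>f \<in> IB \<longleftrightarrow> \<Omega>(f) \<subseteq> I\<close>. Put \<open>\<Omega>(J) = \<Sum>\<^sub>j\<^sub>\<in>\<^sub>J \<Omega>(j)\<close> for an ideal \<open>J\<close>; then \<open>J \<subseteq> IB\<close> iff
  \<open>\<Omega>(J) \<subseteq> I\<close>, so the adjunctions for \<open>R \<rightarrow> S\<close> and \<open>S \<rightarrow> T\<close> compose: the content of \<open>f \<in> T\<close> over \<open>R\<close>
  is the content over \<open>R\<close> of the content of \<open>f\<close> over \<open>S\<close>. Multiplicativity on elements passes to
  ideals because an inclusion \<open>JK \<subseteq> I\<close> can be tested on products of generators.\<close>

lemma ideal_subset_carrier: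
  assumes "ideal I R"
  shows "I \<subseteq> carrier R"
  by (rule additive_subgroup.a_subset[OF ideal.axioms(1)[OF assms]])

section \<open>Ideals and products tested on generators\<close>

context cring
begin

text \<open>This is the colon ideal (I : b). By minimality of generated ideals, it spreads a
  condition \<open>a \<otimes> b \<in> I\<close> from generators \<open>a\<close> to the ideal they
  generate.\<close>

lemma colon_ideal:
  assumes "ideal I R" and "b \<in> carrier R"
  shows "ideal {a \<in> carrier R. a \<otimes> b \<in> I} R"
proof -
  interpret I: ideal I R by fact
  show ?thesis
  proof (rule idealI[OF ring_axioms])
    show "subgroup {a \<in> carrier R. a \<otimes> b \<in> I} (add_monoid R)"
    proof (rule group.subgroupI[OF add.is_group], goal_cases)
      case 2
      have "\<zero> \<in> {a \<in> carrier R. a \<otimes> b \<in> I}" using assms by simp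
      then show ?case by blast
    next
      case (3 a)
      then have "\<ominus> a \<in> {a \<in> carrier R. a \<otimes> b \<in> I}"
        using assms(2) by (simp add: l_minus)
      then show ?case by (simp only: a_inv_def)
    qed (auto simp: assms l_distr)
  next
    fix a x assume a: "a \<in> {a \<in> carrier R. a \<otimes> b \<in> I}" and x: "x \<in> carrier R"
    then have "x \<otimes> (a \<otimes> b) \<in> I" by (simp add: I.I_l_closed)
    then show "x \<otimes> a \<in> {a \<in> carrier R. a \<otimes> b \<in> I}"
      using a x assms by (simp add: m_assoc)
    then show "a \<otimes> x \<in> {a \<in> carrier R. a \<otimes> b \<in> I}"
      using a x by (simp add: m_comm)
  qed
qed

lemma ideal_prod_subset_iff:
  assumes "ideal I R"
  shows "J \<cdot> K \<subseteq> I \<longleftrightarrow> (\<forall>a\<in>J. \<forall>b\<in>K. a \<otimes> b \<in> I)"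
proof
  assume *: "\<forall>a\<in>J. \<forall>b\<in>K. a \<otimes> b \<in> I"
  have "x \<in> I" if "x \<in> J \<cdot> K" for x
    using that
  proof (induction rule: ideal_prod.induct)
    case (sum s1 s2)
    then show ?case
      by (intro additive_subgroup.a_closed[OF ideal.axioms(1)[OF assms]])
  qed (use * in auto)
  then show "J \<cdot> K \<subseteq> I" by blast
qed (blast intro: ideal_prod.prod)

text \<open>Colon ideals are used twice: for fixed \<open>b\<close> in \<open>H\<close>, (I : b)
  contains \<open>G\<close> and hence \<open>Idl G\<close>; then for fixed \<open>a\<close> in
  \<open>Idl G\<close>, (I : a) contains \<open>H\<close> and hence \<open>Idl H\<close>.\<close>

lemma genideal_prod_subset_iff:
  assumes "G \<subseteq> carrier R" and "H \<subseteq> carrier R" and "ideal I R"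
  shows "(Idl G) \<cdot> (Idl H) \<subseteq> I \<longleftrightarrow> (\<forall>a\<in>G. \<forall>b\<in>H. a \<otimes> b \<in> I)"
proof
  assume "(Idl G) \<cdot> (Idl H) \<subseteq> I"
  then show "\<forall>a\<in>G. \<forall>b\<in>H. a \<otimes> b \<in> I"
    using genideal_self[OF assms(1)] genideal_self[OF assms(2)]
    unfolding ideal_prod_subset_iff[OF assms(3)] by blast
next
  assume *: "\<forall>a\<in>G. \<forall>b\<in>H. a \<otimes> b \<in> I"
  have Xb: "a \<otimes> b \<in> I" if "a \<in> Idl G" "b \<in> H" for a b
  proof -
    have b: "b \<in> carrier R" using that assms(2) by blast
    have "G \<subseteq> {a \<in> carrier R. a \<otimes> b \<in> I}" using * assms(1) that by blast
    from genideal_minimal[OF colon_ideal[OF assms(3) b] this] show ?thesis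
      using that by blast
  qed
  have "a \<otimes> b \<in> I" if "a \<in> Idl G" "b \<in> Idl H" for a b
  proof -
    have a: "a \<in> carrier R"
      using that ideal.Icarr[OF genideal_ideal[OF assms(1)]] by blast
    have "H \<subseteq> {c \<in> carrier R. c \<otimes> a \<in> I}"
    proof
      fix y assume y: "y \<in> H"
      then have "y \<in> carrier R" using assms(2) by blast
      then show "y \<in> {c \<in> carrier R. c \<otimes> a \<in> I}"
        using Xb[OF that(1) y] a by (simp add: m_comm)
    qed
    from genideal_minimal[OF colon_ideal[OF assms(3) a] this]
    have "b \<in> {c \<in> carrier R. c \<otimes> a \<in> I}" using that by blast
    then show ?thesis using a by (auto simp: m_comm)
  qed
  then show "(Idl G) \<cdot> (Idl H) \<subseteq> I" by (simp add: ideal_prod_subset_iff[OF assms(3)])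
qed

end

section \<open>Extension and content along a homomorphism\<close>

context ring_hom_cring
begin

lemma ideal_extension_ideal:
  assumes "I \<subseteq> carrier R"
  shows "ideal (ideal_extension S h I) S"
  unfolding ideal_extension_def using assms by (intro S.genideal_ideal) auto

lemma image_subset_ideal_extension:
  assumes "I \<subseteq> carrier R"
  shows "h ` I \<subseteq> ideal_extension S h I"
  unfolding ideal_extension_def using assms by (intro S.genideal_self) auto

lemma ideal_extension_mono:
  assumes "I \<subseteq> J" and "J \<subseteq> carrier R"
  shows "ideal_extension S h I \<subseteq> ideal_extension S h J"
proof -
  have "h ` I \<subseteq> h ` J" using assms(1) by (rule image_mono)
  also have "h ` J \<subseteq> ideal_extension S h J" by (rule image_subset_ideal_extension) fact
  finally show ?thesis
    unfolding ideal_extension_def[of _ _ I]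
    by (rule S.genideal_minimal[OF ideal_extension_ideal[OF assms(2)]])
qed

lemma ideal_extension_genideal:
  assumes "G \<subseteq> carrier R"
  shows "ideal_extension S h (Idl\<^bsub>R\<^esub> G) = ideal_extension S h G"
proof
  have carr: "Idl\<^bsub>R\<^esub> G \<subseteq> carrier R"
    by (intro ideal_subset_carrier R.genideal_ideal assms)
  show "ideal_extension S h G \<subseteq> ideal_extension S h (Idl\<^bsub>R\<^esub> G)"
    by (rule ideal_extension_mono[OF R.genideal_self[OF assms] carr])
  note ext = ideal_extension_ideal[OF assms]
  have hom: "ring_hom_ring R S h"
    by (rule ring_hom_ringI2[OF R.ring_axioms S.ring_axioms homh])
  have "G \<subseteq> {a \<in> carrier R. h a \<in> ideal_extension S h G}"
    using assms image_subset_ideal_extension[OF assms] by blast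
  from R.genideal_minimal[OF ring_hom_ring.ideal_vimage[OF hom ext] this]
  have "h ` (Idl\<^bsub>R\<^esub> G) \<subseteq> ideal_extension S h G" by blast
  then show "ideal_extension S h (Idl\<^bsub>R\<^esub> G) \<subseteq> ideal_extension S h G"
    unfolding ideal_extension_def[of _ _ "Idl\<^bsub>R\<^esub> G"] by (rule S.genideal_minimal[OF ext])
qed

lemma ideal_extension_carrier:
  "ideal_extension S h (carrier R) = carrier S"
proof -
  have "\<one>\<^bsub>S\<^esub> \<in> ideal_extension S h (carrier R)"
    using image_subset_ideal_extension[of "carrier R"] hom_one R.one_closed by force
  then show ?thesis
    using ideal.one_imp_carrier[OF ideal_extension_ideal[of "carrier R"]] by simp
qed

lemma ohm_rush_content_ideal:
  assumes "f \<in> carrier S"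
  shows "ideal (ohm_rush_content R S h f) R"
proof -
  \<comment> \<open>The intersection defining the content needs a member: over an empty family it
    would be \<open>UNIV\<close>. The unit ideal serves, as it extends to all of
    \<open>S\<close>.\<close>
  have "carrier R \<in> {I. ideal I R \<and> f \<in> ideal_extension S h I}"
    using assms by (simp add: ideal_extension_carrier R.oneideal)
  then show ?thesis
    unfolding ohm_rush_content_def by (intro R.i_Intersect) auto
qed

text \<open>The case \<open>I = C\<close> puts \<open>C\<close> into the intersected family, and
  every member contains \<open>C\<close>.\<close>

lemma ohm_rush_content_eqI:
  assumes "ideal C R"
    and "\<And>I. ideal I R \<Longrightarrow> f \<in> ideal_extension S h I \<longleftrightarrow> C \<subseteq> I"
  shows "ohm_rush_content R S h f = C"
  unfolding ohm_rush_content_def using assms by blast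

end

text \<open>Left to right, \<open>I\<close> is one of the intersected ideals. Right to left is the
  Ohm-Rush property combined with monotonicity of extension.\<close>

lemma (in ohm_rush_algebra) mem_ideal_extension_iff:
  assumes "f \<in> carrier B" and "ideal I A"
  shows "f \<in> ideal_extension B h I \<longleftrightarrow> ohm_rush_content A B h f \<subseteq> I"
proof
  assume "ohm_rush_content A B h f \<subseteq> I"
  moreover have "I \<subseteq> carrier A" by (intro ideal_subset_carrier assms)
  ultimately show "f \<in> ideal_extension B h I"
    using ideal_extension_mono mem_extension_content[OF assms(1)] by blast
qed (use assms(2) in \<open>auto simp: ohm_rush_content_def\<close>)

lemma ideal_extension_comp:
  assumes "ring_hom_cring R S \<phi>" and "ring_hom_cring S T \<psi>" and "I \<subseteq> carrier R"
  shows "ideal_extension T (\<psi> \<circ> \<phi>) I = ideal_extension T \<psi> (ideal_extension S \<phi> I)"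
proof -
  interpret \<phi>: ring_hom_cring R S \<phi> by fact
  interpret \<psi>: ring_hom_cring S T \<psi> by fact
  have "\<phi> ` I \<subseteq> carrier S" using assms(3) by auto
  from \<psi>.ideal_extension_genideal[OF this] show ?thesis
    by (simp add: ideal_extension_def image_comp)
qed

text \<open>The possibly infinite sum of contents is encoded as a generated ideal, so that
  inclusions and products can be tested on the union.\<close>

definition ideal_content ::
  "('a, 'm) ring_scheme \<Rightarrow> ('b, 'n) ring_scheme \<Rightarrow> ('a \<Rightarrow> 'b) \<Rightarrow> 'b set \<Rightarrow> 'a set"
  where "ideal_content A B h J = Idl\<^bsub>A\<^esub> (\<Union>j\<in>J. ohm_rush_content A B h j)"

context ohm_rush_algebra
begin

lemma Union_content_subset_carrier:
  assumes "J \<subseteq> carrier B"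
  shows "(\<Union>j\<in>J. ohm_rush_content A B h j) \<subseteq> carrier A"
  using assms by (intro UN_least ideal_subset_carrier ohm_rush_content_ideal) auto

lemma ideal_content_ideal:
  assumes "J \<subseteq> carrier B"
  shows "ideal (ideal_content A B h J) A"
  unfolding ideal_content_def
  by (intro R.genideal_ideal Union_content_subset_carrier assms)

lemma subset_ideal_extension_iff:
  assumes "J \<subseteq> carrier B" and "ideal I A"
  shows "J \<subseteq> ideal_extension B h I \<longleftrightarrow> ideal_content A B h J \<subseteq> I"
proof -
  have "J \<subseteq> ideal_extension B h I \<longleftrightarrow> (\<Union>j\<in>J. ohm_rush_content A B h j) \<subseteq> I"
    unfolding UN_subset_iff subset_eq[of J]
    by (intro ball_cong refl mem_ideal_extension_iff[OF subsetD[OF assms(1)] assms(2)])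
  also have "\<dots> \<longleftrightarrow> ideal_content A B h J \<subseteq> I"
    unfolding ideal_content_def
    by (simp add: R.Idl_subset_ideal[OF assms(2) Union_content_subset_carrier[OF assms(1)]])
  finally show ?thesis .
qed

end

text \<open>For ideals this is \<Omega>(J)\<Omega>(K) = \<Omega>(JK) in adjoint form, which avoids
  computing the content of a sum of products.\<close>

lemma (in gaussian_algebra) ideal_content_prod_subset_iff:
  assumes "J \<subseteq> carrier B" and "K \<subseteq> carrier B" and "ideal I A"
  shows "ideal_content A B h J \<cdot>\<^bsub>A\<^esub> ideal_content A B h K \<subseteq> I \<longleftrightarrow>
    J \<cdot>\<^bsub>B\<^esub> K \<subseteq> ideal_extension B h I"
proof -
  let ?c = "ohm_rush_content A B h"
  have ext: "ideal (ideal_extension B h I) B"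
    by (rule ideal_extension_ideal[OF ideal_subset_carrier[OF assms(3)]])
  have "ideal_content A B h J \<cdot>\<^bsub>A\<^esub> ideal_content A B h K \<subseteq> I \<longleftrightarrow>
      (\<forall>j\<in>J. \<forall>k\<in>K. \<forall>a\<in>?c j. \<forall>b\<in>?c k. a \<otimes>\<^bsub>A\<^esub> b \<in> I)"
    unfolding ideal_content_def
    by (simp add: R.genideal_prod_subset_iff[OF Union_content_subset_carrier[OF assms(1)]
          Union_content_subset_carrier[OF assms(2)] assms(3)]) blast
  also have "\<dots> \<longleftrightarrow> (\<forall>j\<in>J. \<forall>k\<in>K. ?c j \<cdot>\<^bsub>A\<^esub> ?c k \<subseteq> I)"
    by (simp add: R.ideal_prod_subset_iff[OF assms(3)])
  \<comment> \<open>The Gaussian property replaces \<Omega>(j)\<Omega>(k) by \<Omega>(jk), to which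
    the elementwise adjunction applies.\<close>
  also have "\<dots> \<longleftrightarrow> (\<forall>j\<in>J. \<forall>k\<in>K. j \<otimes>\<^bsub>B\<^esub> k \<in> ideal_extension B h I)"
  proof (intro ball_cong refl)
    fix j k assume "j \<in> J" "k \<in> K"
    then have "j \<in> carrier B" "k \<in> carrier B" using assms by auto
    then show "?c j \<cdot>\<^bsub>A\<^esub> ?c k \<subseteq> I \<longleftrightarrow> j \<otimes>\<^bsub>B\<^esub> k \<in> ideal_extension B h I"
      by (simp add: mem_ideal_extension_iff assms(3) content_mult)
  qed
  also have "\<dots> \<longleftrightarrow> J \<cdot>\<^bsub>B\<^esub> K \<subseteq> ideal_extension B h I"
    by (simp add: S.ideal_prod_subset_iff[OF ext])
  finally show ?thesis .
qed

theorem theorem3p13: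
  fixes R :: "('r, 'k) ring_scheme"
    and S :: "('s, 'l) ring_scheme"
    and T :: "('t, 'm) ring_scheme"
    and \<phi> :: "'r \<Rightarrow> 's"
    and \<psi> :: "'s \<Rightarrow> 't"
  assumes "cring R" and "cring S" and "cring T"
    and "\<phi> \<in> ring_hom R S" and "\<psi> \<in> ring_hom S T"
    and "gaussian_algebra R S \<phi>"
    and "gaussian_algebra S T \<psi>"
  shows "gaussian_algebra R T (\<psi> \<circ> \<phi>)"
proof -
  interpret \<phi>: gaussian_algebra R S \<phi> by fact
  interpret \<psi>: gaussian_algebra S T \<psi> by fact
  interpret comp: ring_hom_cring R T "\<psi> \<circ> \<phi>"
    using assms(1,3) ring_hom_trans[OF assms(4,5)]
    by (simp add: ring_hom_cring_def ring_hom_cring_axioms_def)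
  let ?c = "\<lambda>f. ideal_content R S \<phi> (ohm_rush_content S T \<psi> f)"
  have carr: "ohm_rush_content S T \<psi> f \<subseteq> carrier S" if "f \<in> carrier T" for f
    by (intro ideal_subset_carrier \<psi>.ohm_rush_content_ideal that)
  have idl: "ideal (?c f) R" if "f \<in> carrier T" for f
    by (intro \<phi>.ideal_content_ideal carr that)
  \<comment> \<open>Only the adjunction for \<psi> is applied here; stopping in \<open>S\<close>
    lets the product step below use multiplicativity over \<open>S\<close> before descending to
    \<open>R\<close>.\<close>
  have ext: "f \<in> ideal_extension T (\<psi> \<circ> \<phi>) I \<longleftrightarrow>
      ohm_rush_content S T \<psi> f \<subseteq> ideal_extension S \<phi> I"
    if f: "f \<in> carrier T" and I: "ideal I R" for f I
  proof -
    have IR: "I \<subseteq> carrier R" using I by (rule ideal_subset_carrier)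
    show ?thesis
      using \<psi>.mem_ideal_extension_iff[OF f \<phi>.ideal_extension_ideal[OF IR]]
      by (simp add: ideal_extension_comp[OF \<phi>.ring_hom_cring_axioms \<psi>.ring_hom_cring_axioms IR])
  qed
  have adj: "f \<in> ideal_extension T (\<psi> \<circ> \<phi>) I \<longleftrightarrow> ?c f \<subseteq> I"
    if "f \<in> carrier T" "ideal I R" for f I
    using that by (simp add: ext \<phi>.subset_ideal_extension_iff carr)
  have content: "ohm_rush_content R T (\<psi> \<circ> \<phi>) f = ?c f" if "f \<in> carrier T" for f
    by (intro comp.ohm_rush_content_eqI idl adj that)
  show ?thesis
  proof unfold_locales
    show "f \<in> ideal_extension T (\<psi> \<circ> \<phi>) (ohm_rush_content R T (\<psi> \<circ> \<phi>) f)"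
      if "f \<in> carrier T" for f
      \<comment> \<open>The adjunction at \<open>I = ?c f\<close> reduces the Ohm-Rush property to
        \<open>?c f \<subseteq> ?c f\<close>.\<close>
      using that by (simp add: content adj idl)
  next
    fix f g assume fg: "f \<in> carrier T" "g \<in> carrier T"
    have "ohm_rush_content R T (\<psi> \<circ> \<phi>) (f \<otimes>\<^bsub>T\<^esub> g) = ?c f \<cdot>\<^bsub>R\<^esub> ?c g"
    proof (rule comp.ohm_rush_content_eqI)
      show "ideal (?c f \<cdot>\<^bsub>R\<^esub> ?c g) R"
        by (intro \<phi>.R.ideal_prod_is_ideal idl fg)
      \<comment> \<open>By \<open>ext\<close> and the Gaussian property of \<psi>, the left side
        says that the product of the contents of \<open>f\<close> and \<open>g\<close> over
        \<open>S\<close> lies in the extension of \<open>I\<close> to \<open>S\<close>. The Gaussian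
        property of \<phi> turns this into the right side.\<close>
      show "f \<otimes>\<^bsub>T\<^esub> g \<in> ideal_extension T (\<psi> \<circ> \<phi>) I \<longleftrightarrow> ?c f \<cdot>\<^bsub>R\<^esub> ?c g \<subseteq> I"
        if "ideal I R" for I
        using fg that
        by (simp add: ext \<psi>.content_mult \<phi>.ideal_content_prod_subset_iff carr)
    qed
    then show "ohm_rush_content R T (\<psi> \<circ> \<phi>) (f \<otimes>\<^bsub>T\<^esub> g) =
        ohm_rush_content R T (\<psi> \<circ> \<phi>) f \<cdot>\<^bsub>R\<^esub> ohm_rush_content R T (\<psi> \<circ> \<phi>) g"
      using fg by (simp add: content)
  qed
qed

end
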